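(* Let $(X,\{\star_1,\dots,\star_k\})$ be a multispindle with multi-term chain complex $C(X)$ for integer scalars $a_1,\dots,a_k$, and let $t\in X$. Then the chain complex $C(X)$ decomposes as $$C(X)\cong C(\{t\})\oplus\mathcal F^0(X,t)\oplus (C/\mathcal F^0)(X,t).$$ In particular, for all $n$, $$H_n(X)\cong H_n(\{t\})\oplus H_n(\mathcal F^0(X,t))\oplus H_n\big((C/\mathcal F^0)(X,t)\big).$$
   Context: A multispindle $(X,\{\star_1,\dots,\star_k\})$ is a set $X$ with binary operations such that $(x\star_\alpha y)\star_\beta z=(x\star_\beta z)\star_\alpha(y\star_\beta z)$ for all $x,y,z\in X$ and all $\alpha,\beta$ (including $\alpha=\beta$), and $x\star_\alpha x=x$ for all $x,\alpha$. The multi-term chain complex $C(X)$ for integer scalars $a_1,\dots,a_k$ has $C_n(X)=\mathbb Z X^{n+1}$ for $n\ge0$ (zero for $n<0$) and $\partial=\sum_r a_r\partial^{\star_r}$, where $\partial^\star_n=\sum_{i=0}^n(-1)^i d_i^\star$ for $n\ge1$, $\partial_0=0$, $d_0^\star(x_0,\dots,x_n)=(x_1,\dots,x_n)$, and $d_i^\star(x_0,\dots,x_n)=(x_0\star x_i,\dots,x_{i-1}\star x_i,x_{i+1},\dots,x_n)$ for $i\geq1$. $H(X)$ denotes its homology. $C(\{t\})\subset C(X)$ is the subcomplex spanned by tuples $(t,\dots,t)$; $C(X,t):=C(X)/C(\{t\})$. With $s_0(x_0,x_1,\dots,x_n)=(x_0,x_0,x_1,\dots,x_n)$ (also on $C(X,t)$),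 $\mathcal F^0(X,t)\subset C(X,t)$ is the subcomplex $\mathcal F^0_n(X,t)=s_0(C_{n-1}(X,t))$ (zero for $n=0$), and $(C/\mathcal F^0)(X,t):=C(X,t)/\mathcal F^0(X,t)$. *)

theory Defs
  imports "HOL-Algebra.Free_Abelian_Groups"
begin

section \<open>Chain complexes of abelian groups\<close>

text \<open>Complexes are graded by all integers, so that \<open>bdy C n\<close> always maps degree \<open>n\<close> to degree
  \<open>n - 1\<close>; the groups are written multiplicatively, as everywhere in HOL-Algebra.\<close>

record 'c complex_data =
  grp :: "int \<Rightarrow> 'c monoid"
  bdy :: "int \<Rightarrow> 'c \<Rightarrow> 'c"

definition chain_complex :: "'c complex_data \<Rightarrow> bool" where
  "chain_complex C \<longleftrightarrow>
     (\<forall>n. comm_group (grp C n)) \<and>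
     (\<forall>n. bdy C n \<in> hom (grp C n) (grp C (n - 1))) \<and>
     (\<forall>n. \<forall>x \<in> carrier (grp C n). bdy C (n - 1) (bdy C n x) = \<one>\<^bsub>grp C (n - 2)\<^esub>)"

definition complex_iso :: "'c complex_data \<Rightarrow> 'd complex_data \<Rightarrow> bool" where
  "complex_iso C D \<longleftrightarrow>
     chain_complex C \<and> chain_complex D \<and>
     (\<exists>f. (\<forall>n. f n \<in> iso (grp C n) (grp D n)) \<and>
          (\<forall>n. \<forall>x \<in> carrier (grp C n). f (n - 1) (bdy C n x) = bdy D n (f n x)))"

definition complex_sum :: "'c complex_data \<Rightarrow> 'd complex_data \<Rightarrow> ('c \<times> 'd) complex_data" where
  "complex_sum C D =
     \<lparr>grp = (\<lambda>n. grp C n \<times>\<times> grp D n), bdy = (\<lambda>n. map_prod (bdy C n) (bdy D n))\<rparr>"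

definition subcomplex :: "'c complex_data \<Rightarrow> (int \<Rightarrow> 'c set) \<Rightarrow> 'c complex_data" where
  "subcomplex C S = \<lparr>grp = (\<lambda>n. (grp C n)\<lparr>carrier := S n\<rparr>), bdy = bdy C\<rparr>"

text \<open>The map on cosets \<open>M #> x \<mapsto> N #> f x\<close> induced by a homomorphism \<open>f\<close> into \<open>H\<close> which
  carries the subgroup \<open>M\<close> of its domain into the subgroup \<open>N\<close> of \<open>H\<close>.\<close>

definition coset_map :: "'d monoid \<Rightarrow> 'd set \<Rightarrow> ('c \<Rightarrow> 'd) \<Rightarrow> 'c set \<Rightarrow> 'd set" where
  "coset_map H N f A = the_elem ((\<lambda>x. N #>\<^bsub>H\<^esub> f x) ` A)"

definition quotient_complex :: "'c complex_data \<Rightarrow> 'c complex_data \<Rightarrow> 'c set complex_data" where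
  "quotient_complex C D =
     \<lparr>grp = (\<lambda>n. grp C n Mod carrier (grp D n)),
      bdy = (\<lambda>n. coset_map (grp C (n - 1)) (carrier (grp D (n - 1))) (bdy C n))\<rparr>"

definition homology :: "int \<Rightarrow> 'c complex_data \<Rightarrow> 'c set monoid" where
  "homology n C =
     (grp C n)\<lparr>carrier := kernel (grp C n) (grp C (n - 1)) (bdy C n)\<rparr>
       Mod (bdy C (n + 1) ` carrier (grp C (n + 1)))"


section \<open>Multispindles and their multi-term complexes\<close>

locale multispindle =
  fixes X :: "'a set" and k :: nat and star :: "nat \<Rightarrow> 'a \<Rightarrow> 'a \<Rightarrow> 'a"
  assumes closed: "\<lbrakk>r \<in> {1..k}; x \<in> X; y \<in> X\<rbrakk> \<Longrightarrow> star r x y \<in> X"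
    and distrib: "\<lbrakk>r \<in> {1..k}; s \<in> {1..k}; x \<in> X; y \<in> X; z \<in> X\<rbrakk>
      \<Longrightarrow> star s (star r x y) z = star r (star s x z) (star s y z)"
    and idem: "\<lbrakk>r \<in> {1..k}; x \<in> X\<rbrakk> \<Longrightarrow> star r x x = x"

text \<open>The basis \<open>X\<^sup>n\<^sup>+\<^sup>1\<close> of the chains in degree \<open>n\<close>. The condition \<open>0 \<le> n\<close> keeps the empty list
  from contributing a basis element in degree \<open>-1\<close>.\<close>

definition tuples :: "'a set \<Rightarrow> int \<Rightarrow> 'a list set" where
  "tuples X n = {xs. 0 \<le> n \<and> int (length xs) = n + 1 \<and> set xs \<subseteq> X}"

text \<open>For \<open>i = 0\<close> no entry precedes \<open>x\<^sub>i\<close>, so this just deletes \<open>x\<^sub>0\<close>.\<close>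

definition face :: "('a \<Rightarrow> 'a \<Rightarrow> 'a) \<Rightarrow> nat \<Rightarrow> 'a list \<Rightarrow> 'a list" where
  "face op i xs = map (\<lambda>x. op x (xs ! i)) (take i xs) @ drop (Suc i) xs"

definition star_boundary ::
    "('a \<Rightarrow> 'a \<Rightarrow> 'a) \<Rightarrow> int \<Rightarrow> ('a list \<Rightarrow>\<^sub>0 int) \<Rightarrow> ('a list \<Rightarrow>\<^sub>0 int)" where
  "star_boundary op n c =
     (if 1 \<le> n
      then frag_extend (\<lambda>xs. \<Sum>i\<le>nat n. frag_cmul ((-1) ^ i) (frag_of (face op i xs))) c
      else 0)"

definition multiterm_complex ::
    "'a set \<Rightarrow> nat \<Rightarrow> (nat \<Rightarrow> 'a \<Rightarrow> 'a \<Rightarrow> 'a) \<Rightarrow> (nat \<Rightarrow> int) \<Rightarrow> ('a list \<Rightarrow>\<^sub>0 int) complex_data" where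
  "multiterm_complex X k star a =
     \<lparr>grp = (\<lambda>n. free_Abelian_group (tuples X n)),
      bdy = (\<lambda>n c. \<Sum>r = 1..k. frag_cmul (a r) (star_boundary (star r) n c))\<rparr>"

text \<open>\<open>C({t})\<close>, as a subcomplex of \<open>C(X)\<close>. The only element of \<open>tuples {t} n\<close>, for \<open>n \<ge> 0\<close>, is
  \<open>(t, \<dots>, t)\<close>.\<close>

definition point_complex ::
    "'a set \<Rightarrow> nat \<Rightarrow> (nat \<Rightarrow> 'a \<Rightarrow> 'a \<Rightarrow> 'a) \<Rightarrow> (nat \<Rightarrow> int) \<Rightarrow> 'a \<Rightarrow> ('a list \<Rightarrow>\<^sub>0 int) complex_data" where
  "point_complex X k star a t =
     subcomplex (multiterm_complex X k star a)
       (\<lambda>n. generate (grp (multiterm_complex X k star a) n) (frag_of ` tuples {t} n))"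

text \<open>\<open>C(X,t)\<close>\<close>

definition reduced_complex ::
    "'a set \<Rightarrow> nat \<Rightarrow> (nat \<Rightarrow> 'a \<Rightarrow> 'a \<Rightarrow> 'a) \<Rightarrow> (nat \<Rightarrow> int) \<Rightarrow> 'a \<Rightarrow> ('a list \<Rightarrow>\<^sub>0 int) set complex_data" where
  "reduced_complex X k star a t =
     quotient_complex (multiterm_complex X k star a) (point_complex X k star a t)"

definition s0 :: "('a list \<Rightarrow>\<^sub>0 int) \<Rightarrow> ('a list \<Rightarrow>\<^sub>0 int)" where
  "s0 = frag_extend (\<lambda>xs. frag_of (hd xs # xs))"

text \<open>\<open>\<F>\<^sup>0(X,t)\<close>: in degree \<open>n\<close> it is the image of \<open>C\<^sub>n\<^sub>-\<^sub>1(X,t)\<close> under the map induced by \<open>s0\<close>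
  from \<open>C\<^sub>n\<^sub>-\<^sub>1(X,t)\<close> to \<open>C\<^sub>n(X,t)\<close>. It vanishes for \<open>n = 0\<close> because \<open>C\<^sub>-\<^sub>1(X,t)\<close> is trivial.\<close>

definition F0_complex ::
    "'a set \<Rightarrow> nat \<Rightarrow> (nat \<Rightarrow> 'a \<Rightarrow> 'a \<Rightarrow> 'a) \<Rightarrow> (nat \<Rightarrow> int) \<Rightarrow> 'a \<Rightarrow> ('a list \<Rightarrow>\<^sub>0 int) set complex_data" where
  "F0_complex X k star a t =
     subcomplex (reduced_complex X k star a t)
       (\<lambda>n. coset_map (grp (multiterm_complex X k star a) n)
              (carrier (grp (point_complex X k star a t) n)) s0
            ` carrier (grp (reduced_complex X k star a t) (n - 1)))"

text \<open>\<open>(C/\<F>\<^sup>0)(X,t)\<close>\<close>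

definition mod_F0_complex ::
    "'a set \<Rightarrow> nat \<Rightarrow> (nat \<Rightarrow> 'a \<Rightarrow> 'a \<Rightarrow> 'a) \<Rightarrow> (nat \<Rightarrow> int) \<Rightarrow> 'a \<Rightarrow> ('a list \<Rightarrow>\<^sub>0 int) set set complex_data" where
  "mod_F0_complex X k star a t =
     quotient_complex (reduced_complex X k star a t) (F0_complex X k star a t)"

end

theory Submission
  imports Defs
begin

text \<open>A subcomplex \<open>D\<close> of \<open>C\<close> is a direct summand as soon as it is the image of an idempotent chain
  map \<open>\<rho>\<close> of \<open>C\<close>: then \<open>c \<mapsto> (\<rho> c, D + c)\<close> is an isomorphism from \<open>C\<close> to \<open>D \<oplus> C/D\<close>
  (\<open>complex_retraction.splitting\<close>). The theorem applies this twice.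

  The first retraction sends \<open>(x\<^sub>0, \<dots>, x\<^sub>n)\<close> to \<open>(t, \<dots>, t)\<close>. It commutes with all faces because
  \<open>t \<star> t = t\<close> for every operation, and its image is \<open>C({t})\<close>
  (\<open>complex_retraction_collapse\<close>). So \<open>C(X)\<close> is isomorphic to \<open>C({t}) \<oplus> C(X,t)\<close>.

  The second retraction is induced on \<open>C(X,t)\<close> by \<open>r = s\<^sub>0 d\<^sub>0\<close>, that is by
  \<open>(x\<^sub>0, x\<^sub>1, x\<^sub>2, \<dots>) \<mapsto> (x\<^sub>1, x\<^sub>1, x\<^sub>2, \<dots>)\<close>, with \<open>r = 0\<close> in degree \<open>0\<close>. Since \<open>d\<^sub>0\<close> does not
  depend on the operation, \<open>r\<close> is one map for all the operations at once. As \<open>d\<^sub>0 s\<^sub>0\<close> is the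
  identity, \<open>r\<close> fixes the image of \<open>s\<^sub>0\<close> pointwise and maps onto it. It is a chain map
  (\<open>redouble_chain_commutes\<close>) because \<open>d\<^sub>i r = r d\<^sub>i\<close> for \<open>i \<ge> 2\<close>, while \<open>d\<^sub>0 r = d\<^sub>1 r\<close> (here
  idempotence enters) and \<open>r d\<^sub>0 = r d\<^sub>1\<close>, so that in \<open>\<partial> r\<close> and in \<open>r \<partial>\<close> the first two terms
  cancel. Hence \<open>C(X,t)\<close> is isomorphic to \<open>\<F>\<^sup>0(X,t) \<oplus> (C/\<F>\<^sup>0)(X,t)\<close>.

  That \<open>C(X)\<close> is a complex at all uses distributivity across operations: for \<open>i \<le> j\<close> the face \<open>i\<close>
  of \<open>\<star>\<^sub>\<alpha>\<close> after the face \<open>j + 1\<close> of \<open>\<star>\<^sub>\<beta>\<close> equals the face \<open>j\<close> of \<open>\<star>\<^sub>\<beta>\<close> after the face \<open>i\<close> of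
  \<open>\<star>\<^sub>\<alpha>\<close>, and the terms of \<open>\<partial>\<partial>\<close> cancel in pairs that also exchange \<open>\<alpha>\<close> and \<open>\<beta>\<close>. The statement
  on homology follows since homology respects isomorphisms and finite direct sums.\<close>

section \<open>Quotient groups and induced maps on cosets\<close>

text \<open>The first isomorphism theorem for the composite of \<open>h\<close> with the projection onto \<open>H Mod N\<close>.\<close>

lemma FactGroup_iso_FactGroup:
  assumes "group G" and "group H" and h: "h \<in> hom G H" and onto: "h ` carrier G = carrier H"
    and N: "N \<lhd> H" and M: "M = {x \<in> carrier G. h x \<in> N}"
  shows "G Mod M \<cong> H Mod N"
proof -
  interpret N: normal N H by (rule N)
  interpret f: group_hom G "H Mod N" "\<lambda>x. N #>\<^bsub>H\<^esub> h x"
    using hom_compose [OF h N.r_coset_hom_Mod] \<open>group G\<close> N.factorgroup_is_group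
    by (simp add: group_hom_def group_hom_axioms_def o_def)
  have "kernel G (H Mod N) (\<lambda>x. N #>\<^bsub>H\<^esub> h x) = M"
  proof -
    have "N #>\<^bsub>H\<^esub> h x = N \<longleftrightarrow> h x \<in> N" if x: "x \<in> carrier G" for x
    proof -
      have "h x \<in> carrier H"
        using h x by (auto simp: hom_def)
      then show ?thesis
        using N.coset_join1 N.coset_join2 N.is_subgroup by blast
    qed
    then show ?thesis
      by (auto simp: kernel_def M)
  qed
  moreover have "(\<lambda>x. N #>\<^bsub>H\<^esub> h x) ` carrier G = carrier (H Mod N)"
    unfolding carrier_FactGroup onto [symmetric] by (simp add: image_image)
  ultimately show ?thesis
    using f.FactGroup_iso by simp
qed

text \<open>Under these hypotheses every representative of \<open>M #> x\<close> gives the same coset of \<open>N\<close>, so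
  \<open>the_elem\<close> is applied to a singleton.\<close>

lemma coset_map_r_coset:
  assumes "group G" and "group H" and f: "f \<in> hom G H"
    and M: "subgroup M G" and N: "subgroup N H" and "f ` M \<subseteq> N" and x: "x \<in> carrier G"
  shows "coset_map H N f (M #>\<^bsub>G\<^esub> x) = N #>\<^bsub>H\<^esub> f x"
proof -
  interpret f: group_hom G H f
    using assms by (simp add: group_hom_def group_hom_axioms_def)
  have const: "N #>\<^bsub>H\<^esub> f y = N #>\<^bsub>H\<^esub> f x" if y: "y \<in> M #>\<^bsub>G\<^esub> x" for y
  proof -
    obtain m where m: "m \<in> M" "y = m \<otimes>\<^bsub>G\<^esub> x"
      using y by (auto simp: r_coset_def)
    have mc: "m \<in> carrier G" and fm: "f m \<in> N"
      using m subgroup.mem_carrier [OF M] assms(6) by auto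
    have "N #>\<^bsub>H\<^esub> f y = (N #>\<^bsub>H\<^esub> f m) #>\<^bsub>H\<^esub> f x"
      using m mc x by (simp add: f.H.coset_mult_assoc subgroup.subset [OF N])
    then show ?thesis
      using f.H.coset_join2 [of "f m" N] mc fm N by simp
  qed
  have "(\<lambda>y. N #>\<^bsub>H\<^esub> f y) ` (M #>\<^bsub>G\<^esub> x) = {N #>\<^bsub>H\<^esub> f x}"
  proof
    show "{N #>\<^bsub>H\<^esub> f x} \<subseteq> (\<lambda>y. N #>\<^bsub>H\<^esub> f y) ` (M #>\<^bsub>G\<^esub> x)"
      using f.G.rcos_self [OF x M] by blast
  qed (use const in blast)
  then show ?thesis
    by (simp add: coset_map_def)
qed

lemma coset_map_hom:
  assumes "group G" and "group H" and f: "f \<in> hom G H"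
    and M: "M \<lhd> G" and N: "N \<lhd> H" and "f ` M \<subseteq> N"
  shows "coset_map H N f \<in> hom (G Mod M) (H Mod N)"
proof (rule homI)
  interpret M: normal M G by (rule M)
  interpret N: normal N H by (rule N)
  interpret f: group_hom G H f
    using assms by (simp add: group_hom_def group_hom_axioms_def)
  have cm: "coset_map H N f (M #>\<^bsub>G\<^esub> x) = N #>\<^bsub>H\<^esub> f x" if "x \<in> carrier G" for x
    by (rule coset_map_r_coset [OF assms(1-3) M.subgroup_axioms N.subgroup_axioms assms(6) that])
  show "coset_map H N f A \<in> carrier (H Mod N)" if "A \<in> carrier (G Mod M)" for A
    using that by (auto simp: carrier_FactGroup cm)
  show "coset_map H N f (A \<otimes>\<^bsub>G Mod M\<^esub> B) = coset_map H N f A \<otimes>\<^bsub>H Mod N\<^esub> coset_map H N f B"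
    if "A \<in> carrier (G Mod M)" "B \<in> carrier (G Mod M)" for A B
    using that by (auto simp: carrier_FactGroup cm M.rcos_sum N.rcos_sum)
qed

section \<open>Sums, subcomplexes and quotients of chain complexes\<close>

lemma complex_isoI:
  assumes "chain_complex C" and "chain_complex D"
    and "\<And>n. f n \<in> iso (grp C n) (grp D n)"
    and "\<And>n x. x \<in> carrier (grp C n) \<Longrightarrow> f (n - 1) (bdy C n x) = bdy D n (f n x)"
  shows "complex_iso C D"
  unfolding complex_iso_def using assms by (intro conjI exI [of _ f]) simp_all

lemma chain_complex_group_hom:
  assumes "chain_complex C"
  shows "group_hom (grp C n) (grp C (n - 1)) (bdy C n)"
  using assms
  by (simp add: chain_complex_def group_hom_def group_hom_axioms_def comm_group.axioms(2))

lemma (in comm_group) subgroup_is_comm_group: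
  assumes "subgroup H G"
  shows "comm_group (G\<lparr>carrier := H\<rparr>)"
proof -
  interpret H: group "G\<lparr>carrier := H\<rparr>"
    by (rule subgroup_imp_group [OF assms])
  show ?thesis
    using subgroup.mem_carrier [OF assms] by (intro H.group_comm_groupI) (simp add: m_comm)
qed

lemma comm_group_DirProd:
  assumes "comm_group G" and "comm_group H"
  shows "comm_group (G \<times>\<times> H)"
proof -
  interpret G: comm_group G by fact
  interpret H: comm_group H by fact
  interpret group "G \<times>\<times> H"
    by (simp add: DirProd_group)
  show ?thesis
    by (rule group_comm_groupI) (auto simp: G.m_comm H.m_comm)
qed

lemma chain_complex_sum:
  assumes C: "chain_complex C" and D: "chain_complex D"
  shows "chain_complex (complex_sum C D)"
  unfolding chain_complex_def
proof (intro conjI allI ballI)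
  fix n
  show "comm_group (grp (complex_sum C D) n)"
    using C D by (simp add: complex_sum_def chain_complex_def comm_group_DirProd)
  show "bdy (complex_sum C D) n \<in> hom (grp (complex_sum C D) n) (grp (complex_sum C D) (n - 1))"
    using C D by (auto simp: complex_sum_def chain_complex_def hom_def Pi_def)
  show "bdy (complex_sum C D) (n - 1) (bdy (complex_sum C D) n x)
      = \<one>\<^bsub>grp (complex_sum C D) (n - 2)\<^esub>" if "x \<in> carrier (grp (complex_sum C D) n)" for x
    using C D that by (auto simp: complex_sum_def chain_complex_def)
qed

lemma chain_complex_subcomplex:
  assumes C: "chain_complex C" and S: "\<And>n. subgroup (S n) (grp C n)"
    and bdy: "\<And>n x. x \<in> S n \<Longrightarrow> bdy C n x \<in> S (n - 1)"
  shows "chain_complex (subcomplex C S)"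
  unfolding chain_complex_def
proof (intro conjI allI ballI)
  fix n
  interpret comm_group "grp C n"
    using C by (simp add: chain_complex_def)
  show "comm_group (grp (subcomplex C S) n)"
    using subgroup_is_comm_group S by (simp add: subcomplex_def)
  have sub: "S n \<subseteq> carrier (grp C n)"
    using S subgroup.subset by blast
  show "bdy (subcomplex C S) n \<in> hom (grp (subcomplex C S) n) (grp (subcomplex C S) (n - 1))"
    using C bdy sub by (auto simp: chain_complex_def subcomplex_def hom_def Pi_def subset_iff)
  show "bdy (subcomplex C S) (n - 1) (bdy (subcomplex C S) n x)
      = \<one>\<^bsub>grp (subcomplex C S) (n - 2)\<^esub>" if "x \<in> carrier (grp (subcomplex C S) n)" for x
    using that C sub by (auto simp: chain_complex_def subcomplex_def)
qed

lemma bdy_quotient_r_coset: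
  assumes C: "chain_complex C" and S: "\<And>n. subgroup (S n) (grp C n)"
    and bdy: "\<And>n x. x \<in> S n \<Longrightarrow> bdy C n x \<in> S (n - 1)" and x: "x \<in> carrier (grp C n)"
  shows "bdy (quotient_complex C (subcomplex C S)) n (S n #>\<^bsub>grp C n\<^esub> x)
    = S (n - 1) #>\<^bsub>grp C (n - 1)\<^esub> bdy C n x"
proof -
  interpret f: group_hom "grp C n" "grp C (n - 1)" "bdy C n"
    by (rule chain_complex_group_hom [OF C])
  have "bdy C n ` S n \<subseteq> S (n - 1)"
    using bdy by blast
  then show ?thesis
    using coset_map_r_coset [OF f.G.is_group f.H.is_group f.homh S S _ x]
    by (simp add: quotient_complex_def subcomplex_def)
qed

lemma chain_complex_quotient:
  assumes C: "chain_complex C" and S: "\<And>n. subgroup (S n) (grp C n)"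
    and bdy: "\<And>n x. x \<in> S n \<Longrightarrow> bdy C n x \<in> S (n - 1)"
  shows "chain_complex (quotient_complex C (subcomplex C S))"
    (is "chain_complex ?Q")
  unfolding chain_complex_def
proof (intro conjI allI ballI)
  fix n
  interpret f: group_hom "grp C n" "grp C (n - 1)" "bdy C n"
    by (rule chain_complex_group_hom [OF C])
  have cg: "comm_group (grp C m)" for m
    using C by (simp add: chain_complex_def)
  have grp: "grp ?Q m = grp C m Mod S m" for m
    by (simp add: quotient_complex_def subcomplex_def)
  show "comm_group (grp ?Q n)"
    using comm_group.abelian_FactGroup [OF cg S] by (simp add: grp)
  have "bdy C n ` S n \<subseteq> S (n - 1)"
    using bdy by blast
  then show "bdy ?Q n \<in> hom (grp ?Q n) (grp ?Q (n - 1))"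
    using coset_map_hom [OF f.G.is_group f.H.is_group f.homh] cg S
    by (simp add: comm_group.normal_iff_subgroup quotient_complex_def subcomplex_def)
  have bdy_coset: "bdy ?Q m (S m #>\<^bsub>grp C m\<^esub> x) = S (m - 1) #>\<^bsub>grp C (m - 1)\<^esub> bdy C m x"
    if "x \<in> carrier (grp C m)" for m x
    using C S bdy that by (rule bdy_quotient_r_coset)
  fix A assume "A \<in> carrier (grp ?Q n)"
  then obtain x where x: "x \<in> carrier (grp C n)" and A: "A = S n #>\<^bsub>grp C n\<^esub> x"
    by (auto simp: grp carrier_FactGroup)
  have "bdy C (n - 1) (bdy C n x) = \<one>\<^bsub>grp C (n - 1 - 1)\<^esub>"
    using C x by (simp add: chain_complex_def)
  moreover have "S (n - 1 - 1) #>\<^bsub>grp C (n - 1 - 1)\<^esub> \<one>\<^bsub>grp C (n - 1 - 1)\<^esub> = S (n - 1 - 1)"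
    by (rule group.coset_mult_one [OF comm_group.axioms(2) [OF cg] subgroup.subset [OF S]])
  moreover have "bdy ?Q (n - 1) (bdy ?Q n A)
      = S (n - 1 - 1) #>\<^bsub>grp C (n - 1 - 1)\<^esub> bdy C (n - 1) (bdy C n x)"
    by (simp only: A bdy_coset [OF x] bdy_coset [OF f.hom_closed [OF x]])
  ultimately have "bdy ?Q (n - 1) (bdy ?Q n A) = S (n - 1 - 1)"
    by simp
  then show "bdy ?Q (n - 1) (bdy ?Q n A) = \<one>\<^bsub>grp ?Q (n - 2)\<^esub>"
    by (simp add: grp)
qed

section \<open>Idempotent chain maps split complexes\<close>

text \<open>A subcomplex \<open>S\<close> with a retraction \<open>\<rho>\<close> of the whole complex onto it, given by its carriers only: that
  they are subgroups preserved by the boundary follows from \<open>S n\<close> being the image of \<open>\<rho> n\<close> and from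
  \<open>\<rho>\<close> commuting with the boundary.\<close>

locale complex_retraction =
  fixes C :: "'c complex_data" and S :: "int \<Rightarrow> 'c set" and \<rho> :: "int \<Rightarrow> 'c \<Rightarrow> 'c"
  assumes complex: "chain_complex C"
    and hom: "\<rho> n \<in> hom (grp C n) (grp C n)"
    and bdy_commute: "x \<in> carrier (grp C n) \<Longrightarrow> \<rho> (n - 1) (bdy C n x) = bdy C n (\<rho> n x)"
    and image: "\<rho> n ` carrier (grp C n) = S n"
    and fixed: "x \<in> S n \<Longrightarrow> \<rho> n x = x"
begin

lemma comm: "comm_group (grp C n)"
  using complex by (simp add: chain_complex_def)

lemma group_hom_retraction: "group_hom (grp C n) (grp C n) (\<rho> n)"
  by (simp add: group_hom_def group_hom_axioms_def comm_group.axioms(2) comm hom)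

lemma subgroup: "subgroup (S n) (grp C n)"
  using group_hom.img_is_subgroup [OF group_hom_retraction] by (simp add: image)

lemma bdy_closed:
  assumes "x \<in> S n"
  shows "bdy C n x \<in> S (n - 1)"
proof -
  have x: "x \<in> carrier (grp C n)"
    by (rule subgroup.mem_carrier [OF subgroup assms])
  then have "bdy C n x \<in> carrier (grp C (n - 1))"
    by (rule group_hom.hom_closed [OF chain_complex_group_hom [OF complex]])
  moreover have "\<rho> (n - 1) (bdy C n x) = bdy C n x"
    by (simp add: bdy_commute x fixed assms)
  ultimately show ?thesis
    unfolding image [symmetric] by (intro image_eqI) simp_all
qed

lemma complex_sub: "chain_complex (subcomplex C S)"
  by (rule chain_complex_subcomplex [OF complex subgroup bdy_closed])

lemma complex_quotient: "chain_complex (quotient_complex C (subcomplex C S))"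
  by (rule chain_complex_quotient [OF complex subgroup bdy_closed])

lemma bdy_coset:
  assumes "x \<in> carrier (grp C n)"
  shows "bdy (quotient_complex C (subcomplex C S)) n (S n #>\<^bsub>grp C n\<^esub> x)
    = S (n - 1) #>\<^bsub>grp C (n - 1)\<^esub> bdy C n x"
  using complex subgroup bdy_closed assms by (rule bdy_quotient_r_coset)

text \<open>The map \<open>x \<mapsto> (\<rho> x, S + x)\<close> is an isomorphism: an element of its kernel lies in \<open>S\<close>, hence is
  fixed by \<open>\<rho>\<close>, hence vanishes; and the pair \<open>(s, S + y)\<close> is the image of \<open>y + s - \<rho> y\<close>.\<close>

lemma splitting:
  "complex_iso C (complex_sum (subcomplex C S) (quotient_complex C (subcomplex C S)))"
    (is "complex_iso C (complex_sum ?D ?Q)")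
proof -
  let ?f = "\<lambda>n x. (\<rho> n x, S n #>\<^bsub>grp C n\<^esub> x)"
  have iso: "?f n \<in> iso (grp C n) (grp (complex_sum ?D ?Q) n)" for n
  proof -
    interpret comm_group "grp C n" by (rule comm)
    interpret S: normal "S n" "grp C n"
      by (simp add: subgroup subgroup_imp_normal)
    interpret r: group_hom "grp C n" "grp C n" "\<rho> n"
      by (rule group_hom_retraction)
    let ?H = "(grp C n)\<lparr>carrier := S n\<rparr> \<times>\<times> (grp C n Mod S n)"
    have "group ?H"
      by (rule DirProd_group [OF subgroup_imp_group [OF subgroup] S.factorgroup_is_group])
    moreover have "\<rho> n \<in> hom (grp C n) ((grp C n)\<lparr>carrier := S n\<rparr>)"
      using image by (auto simp: hom_def)
    then have "?f n \<in> hom (grp C n) ?H"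
      by (simp add: hom_paired S.r_coset_hom_Mod)
    ultimately interpret f: group_hom "grp C n" ?H "?f n"
      by (simp add: group_hom_def group_hom_axioms_def)
    have "?f n \<in> iso (grp C n) ?H"
      unfolding f.iso_iff
    proof (intro conjI subsetI ballI impI)
      fix z assume "z \<in> carrier ?H"
      then obtain s y where s: "s \<in> S n" and y: "y \<in> carrier (grp C n)"
        and z: "z = (s, S n #>\<^bsub>grp C n\<^esub> y)"
        by (auto simp: carrier_FactGroup)
      \<comment> \<open>Correct the representative \<open>y\<close> inside its coset so that it retracts to \<open>s\<close>.\<close>
      define u where "u = s \<otimes>\<^bsub>grp C n\<^esub> inv\<^bsub>grp C n\<^esub> \<rho> n y"
      have ry: "\<rho> n y \<in> S n"
        using image y by blast
      have u: "u \<in> S n" "u \<in> carrier (grp C n)"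
        using s ry by (simp_all add: u_def)
      have "\<rho> n (u \<otimes>\<^bsub>grp C n\<^esub> y) = s"
        using u y s ry by (simp add: fixed u_def m_assoc)
      moreover have "S n #>\<^bsub>grp C n\<^esub> (u \<otimes>\<^bsub>grp C n\<^esub> y) = S n #>\<^bsub>grp C n\<^esub> y"
        using coset_mult_assoc [OF S.subset u(2) y] coset_join2 [OF u(2) subgroup u(1)] by simp
      ultimately show "z \<in> ?f n ` carrier (grp C n)"
        using u y by (intro image_eqI [of _ _ "u \<otimes>\<^bsub>grp C n\<^esub> y"]) (simp_all add: z)
    next
      fix x assume x: "x \<in> carrier (grp C n)" and "?f n x = \<one>\<^bsub>?H\<^esub>"
      then have "\<rho> n x = \<one>\<^bsub>grp C n\<^esub>" and "S n #>\<^bsub>grp C n\<^esub> x = S n"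
        by simp_all
      moreover from this have "x \<in> S n"
        using coset_join1 [OF _ x subgroup] by blast
      ultimately show "x = \<one>\<^bsub>grp C n\<^esub>"
        using fixed by simp
    qed
    then show ?thesis
      by (simp add: complex_sum_def subcomplex_def quotient_complex_def)
  qed
  have commute: "?f (n - 1) (bdy C n x) = bdy (complex_sum ?D ?Q) n (?f n x)"
    if "x \<in> carrier (grp C n)" for n x
    using bdy_commute [OF that] bdy_coset [OF that]
    by (simp add: complex_sum_def subcomplex_def)
  have "chain_complex (complex_sum ?D ?Q)"
    by (intro chain_complex_sum complex_sub complex_quotient)
  then show ?thesis
    using complex iso commute by (intro complex_isoI [where f = ?f])
qed

end

lemma complex_iso_trans:
  assumes "complex_iso C D" and "complex_iso D E"
  shows "complex_iso C E"
proof -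
  obtain f where f: "\<And>n. f n \<in> iso (grp C n) (grp D n)"
      "\<And>n x. x \<in> carrier (grp C n) \<Longrightarrow> f (n - 1) (bdy C n x) = bdy D n (f n x)"
    using assms(1) unfolding complex_iso_def by blast
  obtain g where g: "\<And>n. g n \<in> iso (grp D n) (grp E n)"
      "\<And>n x. x \<in> carrier (grp D n) \<Longrightarrow> g (n - 1) (bdy D n x) = bdy E n (g n x)"
    using assms(2) unfolding complex_iso_def by blast
  have "f n x \<in> carrier (grp D n)" if "x \<in> carrier (grp C n)" for n x
    using f(1) [of n] that by (auto simp: iso_def hom_def)
  then show ?thesis
    using assms iso_set_trans [OF f(1) g(1)] f(2) g(2)
    by (intro complex_isoI [where f = "\<lambda>n. g n \<circ> f n"]) (simp_all add: complex_iso_def)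
qed

lemma complex_iso_sum_right:
  assumes B: "chain_complex B" and "complex_iso C D"
  shows "complex_iso (complex_sum B C) (complex_sum B D)"
proof -
  obtain f where f: "\<And>n. f n \<in> iso (grp C n) (grp D n)"
      "\<And>n x. x \<in> carrier (grp C n) \<Longrightarrow> f (n - 1) (bdy C n x) = bdy D n (f n x)"
    and CD: "chain_complex C" "chain_complex D"
    using assms(2) unfolding complex_iso_def by blast
  let ?f = "\<lambda>n (b, c). (b, f n c)"
  have "group (grp B n)" "group (grp C n)" for n
    using B CD by (auto simp: chain_complex_def comm_group_def)
  then have "?f n \<in> iso (grp (complex_sum B C) n) (grp (complex_sum B D) n)" for n
    using f(1) iso_set_refl by (simp add: complex_sum_def iso_paired2)
  moreover have "?f (n - 1) (bdy (complex_sum B C) n x) = bdy (complex_sum B D) n (?f n x)"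
    if "x \<in> carrier (grp (complex_sum B C) n)" for n x
    using that f(2) by (auto simp: complex_sum_def)
  ultimately show ?thesis
    using B CD by (intro complex_isoI [where f = ?f] chain_complex_sum)
qed

section \<open>Homology of isomorphic complexes and of sums\<close>

abbreviation cycles :: "'c complex_data \<Rightarrow> int \<Rightarrow> 'c set" where
  "cycles C n \<equiv> kernel (grp C n) (grp C (n - 1)) (bdy C n)"

abbreviation boundaries :: "'c complex_data \<Rightarrow> int \<Rightarrow> 'c set" where
  "boundaries C n \<equiv> bdy C (n + 1) ` carrier (grp C (n + 1))"

lemma comm_group_cycles:
  assumes "chain_complex C"
  shows "comm_group ((grp C n)\<lparr>carrier := cycles C n\<rparr>)"
proof (rule comm_group.subgroup_is_comm_group)
  show "comm_group (grp C n)"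
    using assms by (simp add: chain_complex_def)
  show "subgroup (cycles C n) (grp C n)"
    by (rule group_hom.subgroup_kernel [OF chain_complex_group_hom [OF assms]])
qed

lemma boundaries_subset_cycles:
  assumes "chain_complex C"
  shows "boundaries C n \<subseteq> cycles C n"
proof -
  have "bdy C n (bdy C (n + 1) x) = \<one>\<^bsub>grp C (n - 1)\<^esub>" if "x \<in> carrier (grp C (n + 1))" for x
  proof -
    have "bdy C (n + 1 - 1) (bdy C (n + 1) x) = \<one>\<^bsub>grp C (n + 1 - 2)\<^esub>"
      using assms that unfolding chain_complex_def by blast
    moreover have "n + 1 - 2 = n - 1"
      by simp
    ultimately show ?thesis
      by simp
  qed
  then show ?thesis
    using group_hom.hom_closed [OF chain_complex_group_hom [OF assms, of "n + 1"]]
    by (auto simp: kernel_def)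
qed

lemma boundaries_normal:
  assumes "chain_complex C"
  shows "boundaries C n \<lhd> (grp C n)\<lparr>carrier := cycles C n\<rparr>"
proof -
  interpret d: group_hom "grp C n" "grp C (n - 1)" "bdy C n"
    by (rule chain_complex_group_hom [OF assms])
  have "group_hom (grp C (n + 1)) (grp C n) (bdy C (n + 1))"
    using chain_complex_group_hom [OF assms, of "n + 1"] by simp
  then have "subgroup (boundaries C n) (grp C n)"
    by (rule group_hom.img_is_subgroup)
  then have "subgroup (boundaries C n) ((grp C n)\<lparr>carrier := cycles C n\<rparr>)"
    using boundaries_subset_cycles [OF assms] d.subgroup_kernel d.G.subgroup_incl by blast
  then show ?thesis
    using comm_group.subgroup_imp_normal comm_group_cycles [OF assms] by blast
qed

text \<open>An isomorphism \<open>f\<close> of complexes maps cycles onto cycles, and by injectivity a chain is a boundary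
  if and only if its image is one; so \<open>FactGroup_iso_FactGroup\<close> applies to \<open>f\<close> on cycles.\<close>

lemma homology_complex_iso:
  assumes "complex_iso C D"
  shows "homology n C \<cong> homology n D"
proof -
  obtain f where f: "\<And>n. f n \<in> iso (grp C n) (grp D n)"
      "\<And>n x. x \<in> carrier (grp C n) \<Longrightarrow> f (n - 1) (bdy C n x) = bdy D n (f n x)"
    and CD: "chain_complex C" "chain_complex D"
    using assms unfolding complex_iso_def by blast
  interpret C: group_hom "grp C n" "grp C (n - 1)" "bdy C n"
    by (rule chain_complex_group_hom [OF CD(1)])
  have hom: "f m \<in> hom (grp C m) (grp D m)" and inj: "inj_on (f m) (carrier (grp C m))"
    and onto: "f m ` carrier (grp C m) = carrier (grp D m)" for m
    using f(1) by (simp_all add: iso_iff)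
  have one: "f m x = \<one>\<^bsub>grp D m\<^esub> \<longleftrightarrow> x = \<one>\<^bsub>grp C m\<^esub>" if "x \<in> carrier (grp C m)" for m x
  proof -
    have "group (grp C m)" "group (grp D m)"
      using CD by (simp_all add: chain_complex_def comm_group_def)
    then show ?thesis
      using that inj hom by (metis hom_one inj_on_one_iff')
  qed
  have cyc: "f n x \<in> cycles D n \<longleftrightarrow> x \<in> cycles C n" if "x \<in> carrier (grp C n)" for x
    using that one [of "bdy C n x" "n - 1"] f(2) [OF that] hom
    by (auto simp: kernel_def hom_def)
  have bnd: "f n ` boundaries C n = boundaries D n"
  proof -
    have "f n ` boundaries C n = (\<lambda>x. bdy D (n + 1) (f (n + 1) x)) ` carrier (grp C (n + 1))"
      using f(2) [of _ "n + 1"] by (simp add: image_image)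
    then show ?thesis
      using onto [of "n + 1"] by (metis image_image)
  qed
  show ?thesis
    unfolding homology_def
  proof (rule FactGroup_iso_FactGroup)
    show "f n \<in> hom ((grp C n)\<lparr>carrier := cycles C n\<rparr>) ((grp D n)\<lparr>carrier := cycles D n\<rparr>)"
      using hom cyc by (auto simp: hom_def kernel_def)
    show "f n ` carrier ((grp C n)\<lparr>carrier := cycles C n\<rparr>) = carrier ((grp D n)\<lparr>carrier := cycles D n\<rparr>)"
    proof -
      have "f n ` cycles C n = cycles D n"
      proof
        show "f n ` cycles C n \<subseteq> cycles D n"
          using cyc by (auto simp: kernel_def)
        show "cycles D n \<subseteq> f n ` cycles C n"
        proof
          fix y assume y: "y \<in> cycles D n"
          then have "y \<in> f n ` carrier (grp C n)"
            using onto by (simp add: kernel_def)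
          with y cyc show "y \<in> f n ` cycles C n" by blast
        qed
      qed
      then show ?thesis by simp
    qed
    have "x \<in> boundaries C n \<longleftrightarrow> f n x \<in> boundaries D n" if "x \<in> cycles C n" for x
    proof -
      have "x \<in> carrier (grp C n)"
        using that by (simp add: kernel_def)
      moreover have "boundaries C n \<subseteq> carrier (grp C n)"
        using boundaries_subset_cycles [OF CD(1)] by (auto simp: kernel_def)
      ultimately show ?thesis
        unfolding bnd [symmetric] by (simp only: inj_on_image_mem_iff [OF inj])
    qed
    then show "boundaries C n = {x \<in> carrier ((grp C n)\<lparr>carrier := cycles C n\<rparr>). f n x \<in> boundaries D n}"
      using boundaries_subset_cycles [OF CD(1), of n] by simp blast
  qed (use CD in \<open>simp_all add: comm_group_cycles comm_group.axioms(2) boundaries_normal\<close>)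
qed

text \<open>Cycles and boundaries of a sum are formed componentwise, so this is the fact that quotients of
  groups commute with direct products.\<close>

lemma homology_complex_sum:
  assumes C: "chain_complex C" and D: "chain_complex D"
  shows "homology n (complex_sum C D) \<cong> homology n C \<times>\<times> homology n D"
proof -
  let ?Z = "\<lambda>E. (grp E n)\<lparr>carrier := cycles E n\<rparr>"
  have "?Z (complex_sum C D) = ?Z C \<times>\<times> ?Z D"
    by (auto simp: complex_sum_def DirProd_def kernel_def)
  moreover have "boundaries (complex_sum C D) n = boundaries C n \<times> boundaries D n"
    by (simp add: complex_sum_def map_prod_def image_paired_Times)
  ultimately have "homology n (complex_sum C D)
      = (?Z C \<times>\<times> ?Z D) Mod (boundaries C n \<times> boundaries D n)"
    by (simp add: homology_def)
  then show ?thesis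
    unfolding homology_def
    using group.FactGroup_DirProd_multiplication_iso_2
      [OF comm_group.axioms(2) [OF comm_group_cycles [OF C]]
        comm_group.axioms(2) [OF comm_group_cycles [OF D]]
        boundaries_normal [OF C] boundaries_normal [OF D]]
    by simp
qed

lemma group_homology:
  assumes "chain_complex C"
  shows "group (homology n C)"
  unfolding homology_def using boundaries_normal [OF assms] by (rule normal.factorgroup_is_group)

section \<open>Linear extensions between free abelian groups\<close>

lemma frag_extend_frag_extend:
  "frag_extend f (frag_extend g c) = frag_extend (\<lambda>x. frag_extend f (g x)) c"
  using subset_UNIV [of "Poly_Mapping.keys c"]
  by (induction c rule: frag_induction) (auto simp: frag_extend_diff)

lemma sum_frag_cmul_frag_extend:
  "(\<Sum>r\<in>R. frag_cmul (a r) (frag_extend (f r) c))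
    = frag_extend (\<lambda>x. \<Sum>r\<in>R. frag_cmul (a r) (f r x)) c"
  unfolding frag_extend_def frag_cmul_sum
  by (subst sum.swap) (simp add: mult.commute)

lemma frag_extend_hom:
  assumes "\<And>x. x \<in> S \<Longrightarrow> Poly_Mapping.keys (f x) \<subseteq> T"
  shows "frag_extend f \<in> hom (free_Abelian_group S) (free_Abelian_group T)"
proof (rule homI)
  fix c assume "c \<in> carrier (free_Abelian_group S)"
  then have "Poly_Mapping.keys c \<subseteq> S"
    by simp
  then have "(\<Union>x \<in> Poly_Mapping.keys c. Poly_Mapping.keys (f x)) \<subseteq> T"
    using assms by blast
  then show "frag_extend f c \<in> carrier (free_Abelian_group T)"
    using keys_frag_extend [of f c] by simp
qed (simp add: frag_extend_add)

lemma frag_extend_fixed: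
  assumes "\<And>x. x \<in> Poly_Mapping.keys c \<Longrightarrow> f x = frag_of x"
  shows "frag_extend f c = c"
proof -
  have "frag_extend f c = frag_extend frag_of c"
    using assms by (rule frag_extend_eq)
  then show ?thesis
    by (simp flip: frag_expansion)
qed

lemma generate_frag_of:
  assumes "T \<subseteq> S"
  shows "generate (free_Abelian_group S) (frag_of ` T) = carrier (free_Abelian_group T)"
proof
  interpret group "free_Abelian_group S" by simp
  have "c \<in> carrier (free_Abelian_group T)"
    if "c \<in> generate (free_Abelian_group S) (frag_of ` T)" for c
    using that
  proof (induction c rule: generate.induct)
    case (inv h)
    then show ?case
      using assms by auto
  next
    case (eng h1 h2)
    then show ?case
      using keys_add [of h1 h2] by auto
  qed auto
  then show "generate (free_Abelian_group S) (frag_of ` T) \<subseteq> carrier (free_Abelian_group T)"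
    by blast
  have gen: "subgroup (generate (free_Abelian_group S) (frag_of ` T)) (free_Abelian_group S)"
    using assms by (intro generate_is_subgroup) auto
  have "c \<in> generate (free_Abelian_group S) (frag_of ` T)" if "Poly_Mapping.keys c \<subseteq> T" for c
    using that
  proof (induction c rule: frag_induction)
    case zero
    then show ?case
      using subgroup.one_closed [OF gen] by simp
  next
    case (one x)
    then show ?case
      by (simp add: generate.incl)
  next
    case (diff x y)
    have "Poly_Mapping.keys y \<subseteq> S"
      using subgroup.mem_carrier [OF gen diff(2)] by simp
    then have "- y \<in> generate (free_Abelian_group S) (frag_of ` T)"
      using subgroup.m_inv_closed [OF gen diff(2)] by simp
    then show ?case
      using subgroup.m_closed [OF gen diff(1)] by fastforce
  qed
  then show "carrier (free_Abelian_group T) \<subseteq> generate (free_Abelian_group S) (frag_of ` T)"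
    by auto
qed

section \<open>Faces of tuples\<close>

lemma length_face: "i < length xs \<Longrightarrow> length (face op i xs) = length xs - 1"
  by (simp add: face_def)

lemma nth_face:
  assumes "i < length xs" and "Suc l < length xs"
  shows "face op i xs ! l = (if l < i then op (xs ! l) (xs ! i) else xs ! Suc l)"
  using assms by (auto simp: face_def nth_append min_def)

text \<open>With \<open>\<star>\<close> for \<open>op\<close> and \<open>\<star>'\<close> for \<open>op'\<close>: in the positions \<open>l < i\<close> the entries are
  \<open>(x\<^sub>l \<star>' z) \<star> (x\<^sub>i \<star>' z)\<close> and \<open>(x\<^sub>l \<star> x\<^sub>i) \<star>' z\<close>, where \<open>z\<close> is the entry \<open>j + 1\<close>, and this is where
  distributivity enters. For \<open>i \<le> l < j\<close> both entries are the entry \<open>l + 1\<close> multiplied by \<open>z\<close>, and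
  from \<open>j\<close> on both are the entry \<open>l + 2\<close>.\<close>

lemma face_face:
  assumes "i \<le> j" and "Suc j < length xs"
    and "\<And>x y z. \<lbrakk>x \<in> set xs; y \<in> set xs; z \<in> set xs\<rbrakk>
      \<Longrightarrow> op' (op x y) z = op (op' x z) (op' y z)"
  shows "face op i (face op' (Suc j) xs) = face op' j (face op i xs)"
proof (rule nth_equalityI)
  show "length (face op i (face op' (Suc j) xs)) = length (face op' j (face op i xs))"
    using assms by (simp add: length_face)
  fix l assume "l < length (face op i (face op' (Suc j) xs))"
  then have "Suc (Suc l) < length xs"
    using assms by (simp add: length_face)
  then show "face op i (face op' (Suc j) xs) ! l = face op' j (face op i xs) ! l"
    using assms by (simp add: nth_face length_face)
qed

lemma face_replicate:
  assumes "op t t = t" and "i \<le> n"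
  shows "face op i (replicate (Suc n) t) = replicate n t"
  using assms by (intro nth_equalityI) (simp_all add: length_face nth_face del: replicate_Suc)

text \<open>This is \<open>s\<^sub>0 d\<^sub>0\<close> on basis elements: \<open>(x\<^sub>0, x\<^sub>1, x\<^sub>2, \<dots>) \<mapsto> (x\<^sub>1, x\<^sub>1, x\<^sub>2, \<dots>)\<close>.\<close>

definition redouble :: "'a list \<Rightarrow> 'a list" where
  "redouble xs = hd (tl xs) # tl xs"

text \<open>How \<open>s\<^sub>0 d\<^sub>0\<close> meets the faces. The faces 0 and 1 agree on its image, by idempotence, and they become
  equal when it is applied after them, since they differ only in the first entry, which \<open>d\<^sub>0\<close> drops;
  the higher faces commute with it. The tuples are spelled out so far that the entries which the
  identities speak of exist.\<close>

lemma face_0_redouble: "face op 0 (redouble (x # y # ys)) = y # ys"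
  and face_1_redouble: "op y y = y \<Longrightarrow> face op (Suc 0) (redouble (x # y # ys)) = y # ys"
  and redouble_face_01: "redouble (face op (Suc 0) (x # y # z # zs)) = redouble (face op 0 (x # y # z # zs))"
  and redouble_face: "redouble (face op (Suc (Suc i)) (x # y # ys)) = face op (Suc (Suc i)) (redouble (x # y # ys))"
  by (simp_all add: redouble_def face_def)

lemma face_in_tuples:
  assumes "xs \<in> tuples X n" and "1 \<le> n" and "i \<le> nat n"
    and "\<And>x y. \<lbrakk>x \<in> X; y \<in> X\<rbrakk> \<Longrightarrow> op x y \<in> X"
  shows "face op i xs \<in> tuples X (n - 1)"
proof -
  have xs: "i < length xs" "length xs = Suc (nat n)" "set xs \<subseteq> X"
    using assms(1-3) by (auto simp: tuples_def)
  then have "set (take i xs) \<subseteq> X" "set (drop (Suc i) xs) \<subseteq> X" "xs ! i \<in> X"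
    using set_take_subset set_drop_subset by (fastforce dest: nth_mem)+
  then have "set (face op i xs) \<subseteq> X"
    using assms(4) by (auto simp: face_def)
  then show ?thesis
    using xs assms(2) by (simp add: tuples_def length_face)
qed

section \<open>The multi-term boundary\<close>

text \<open>Collecting all operations in one value on basis elements turns the boundary into a single
  \<open>frag_extend\<close>, so that identities of chain maps can be checked on tuples.\<close>

definition tuple_boundary ::
    "nat \<Rightarrow> (nat \<Rightarrow> 'a \<Rightarrow> 'a \<Rightarrow> 'a) \<Rightarrow> (nat \<Rightarrow> int) \<Rightarrow> nat \<Rightarrow> 'a list \<Rightarrow> ('a list \<Rightarrow>\<^sub>0 int)" where
  "tuple_boundary k star a n xs =
     (\<Sum>r=1..k. frag_cmul (a r) (\<Sum>i\<le>n. frag_cmul ((-1) ^ i) (frag_of (face (star r) i xs))))"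

lemma bdy_multiterm_complex:
  "bdy (multiterm_complex X k star a) n c
    = (if 1 \<le> n then frag_extend (tuple_boundary k star a (nat n)) c else 0)"
  by (simp add: multiterm_complex_def star_boundary_def sum_frag_cmul_frag_extend
      tuple_boundary_def [abs_def])

lemma grp_multiterm_complex [simp]:
  "grp (multiterm_complex X k star a) n = free_Abelian_group (tuples X n)"
  by (simp add: multiterm_complex_def)

lemma frag_extend_tuple_boundary:
  "frag_extend f (tuple_boundary k star a n xs)
    = (\<Sum>r=1..k. frag_cmul (a r) (\<Sum>i\<le>n. frag_cmul ((-1) ^ i) (f (face (star r) i xs))))"
  by (simp add: tuple_boundary_def frag_extend_sum frag_extend_cmul o_def)

text \<open>For the row \<open>i\<close> of a double sum over faces: the terms with \<open>j \<le> i\<close> stay, and those with \<open>j > i\<close>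
  are renumbered so that both parts have indices up to \<open>p\<close>.\<close>

lemma sum_split_at:
  fixes g :: "nat \<Rightarrow> 'b :: comm_monoid_add"
  assumes "i \<le> p"
  shows "(\<Sum>j\<le>Suc p. g j)
    = (\<Sum>j\<le>p. if j \<le> i then g j else 0) + (\<Sum>j\<le>p. if i \<le> j then g (Suc j) else 0)"
  using assms
proof (induction p rule: dec_induct)
  case base
  have "(\<Sum>j\<le>i. if i \<le> j then g (Suc j) else 0) = (\<Sum>j\<le>i. if j = i then g (Suc j) else 0)"
    by (intro sum.cong) auto
  then show ?case
    by simp
next
  case (step p)
  then show ?case
    by (simp add: ac_simps)
qed

text \<open>The cancellation behind \<open>\<partial>\<partial> = 0\<close> for a family of face maps indexed by \<open>R\<close>. The term \<open>T r i s j\<close>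
  stands for the face \<open>i\<close> of \<open>r\<close> after the face \<open>j\<close> of \<open>s\<close>, with its sign. If \<open>U r s\<close> collects the
  terms with \<open>j \<le> i\<close>, the remaining terms add up to \<open>- U s r\<close>. For \<open>r \<noteq> s\<close> these need not cancel
  each other; they cancel in the sum over all pairs.\<close>

lemma presimplicial_sum_cancels:
  fixes T :: "'r \<Rightarrow> nat \<Rightarrow> 'r \<Rightarrow> nat \<Rightarrow> 'b :: ab_group_add"
  assumes T: "\<And>r s i j. \<lbrakk>r \<in> R; s \<in> R; i \<le> j; j \<le> p\<rbrakk> \<Longrightarrow> T r i s (Suc j) = - T s j r i"
  shows "(\<Sum>s\<in>R. \<Sum>j\<le>Suc p. \<Sum>r\<in>R. \<Sum>i\<le>p. T r i s j) = 0"
proof -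
  define U where "U r s = (\<Sum>i\<le>p. \<Sum>j\<le>p. if j \<le> i then T r i s j else 0)" for r s
  have inner: "(\<Sum>j\<le>Suc p. \<Sum>i\<le>p. T r i s j) = U r s - U s r" if "r \<in> R" "s \<in> R" for r s
  proof -
    have "(\<Sum>j\<le>Suc p. \<Sum>i\<le>p. T r i s j) = (\<Sum>i\<le>p. \<Sum>j\<le>Suc p. T r i s j)"
      by (rule sum.swap)
    also have "\<dots> = (\<Sum>i\<le>p. (\<Sum>j\<le>p. if j \<le> i then T r i s j else 0)
        + (\<Sum>j\<le>p. if i \<le> j then T r i s (Suc j) else 0))"
      by (rule sum.cong [OF refl], rule sum_split_at) simp
    also have "\<dots> = U r s + (\<Sum>i\<le>p. \<Sum>j\<le>p. if i \<le> j then T r i s (Suc j) else 0)"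
      by (simp only: U_def sum.distrib)
    also have "(\<Sum>i\<le>p. \<Sum>j\<le>p. if i \<le> j then T r i s (Suc j) else 0)
        = (\<Sum>i\<le>p. \<Sum>j\<le>p. - (if i \<le> j then T s j r i else 0))"
      using that by (intro sum.cong refl) (simp add: T)
    also have "\<dots> = - U s r"
      unfolding U_def by (subst sum.swap) (simp add: sum_negf)
    finally show ?thesis
      by simp
  qed
  have "(\<Sum>s\<in>R. \<Sum>j\<le>Suc p. \<Sum>r\<in>R. \<Sum>i\<le>p. T r i s j)
      = (\<Sum>s\<in>R. \<Sum>r\<in>R. \<Sum>j\<le>Suc p. \<Sum>i\<le>p. T r i s j)"
    by (intro sum.cong refl sum.swap)
  also have "\<dots> = (\<Sum>s\<in>R. \<Sum>r\<in>R. U r s - U s r)"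
    by (intro sum.cong refl inner)
  also have "\<dots> = (\<Sum>s\<in>R. \<Sum>r\<in>R. U r s) - (\<Sum>s\<in>R. \<Sum>r\<in>R. U s r)"
    by (simp only: sum_subtractf)
  also have "(\<Sum>s\<in>R. \<Sum>r\<in>R. U s r) = (\<Sum>s\<in>R. \<Sum>r\<in>R. U r s)"
    by (rule sum.swap)
  finally show ?thesis
    by simp
qed

context multispindle
begin

lemma tuple_boundary_closed:
  assumes "xs \<in> tuples X n" and "1 \<le> n"
  shows "tuple_boundary k star a (nat n) xs \<in> carrier (free_Abelian_group (tuples X (n - 1)))"
proof -
  have face: "frag_of (face (star r) i xs) \<in> carrier (free_Abelian_group (tuples X (n - 1)))"
    if "r \<in> {1..k}" "i \<le> nat n" for r i
    using face_in_tuples [OF assms that(2)] closed [OF that(1)] by simp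
  have cmul: "frag_cmul z c \<in> carrier (free_Abelian_group (tuples X (n - 1)))"
    if "c \<in> carrier (free_Abelian_group (tuples X (n - 1)))" for z c
    using that keys_cmul [of z c] by auto
  show ?thesis
    unfolding tuple_boundary_def
    by (intro sum_closed_free_Abelian_group cmul face) simp_all
qed

lemma tuple_boundary_tuple_boundary:
  assumes "xs \<in> tuples X (int (Suc (Suc p)))"
  shows "frag_extend (tuple_boundary k star a (Suc p)) (tuple_boundary k star a (Suc (Suc p)) xs) = 0"
proof -
  have len: "length xs = Suc (Suc (Suc p))" and X: "set xs \<subseteq> X"
    using assms by (auto simp: tuples_def)
  define T where "T r i s j =
      frag_cmul (a s * (-1) ^ j * (a r * (-1) ^ i)) (frag_of (face (star r) i (face (star s) j xs)))"
    for r i s j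
  have "T r i s (Suc j) = - T s j r i"
    if "r \<in> {1..k}" "s \<in> {1..k}" "i \<le> j" "j \<le> Suc p" for r s i j
  proof -
    have "face (star r) i (face (star s) (Suc j) xs) = face (star s) j (face (star r) i xs)"
      using that len X distrib by (intro face_face) (auto simp: subset_iff)
    then show ?thesis
      by (simp add: T_def mult_ac)
  qed
  then have "(\<Sum>s=1..k. \<Sum>j\<le>Suc (Suc p). \<Sum>r=1..k. \<Sum>i\<le>Suc p. T r i s j) = 0"
    by (rule presimplicial_sum_cancels)
  then show ?thesis
    unfolding frag_extend_tuple_boundary T_def
    by (simp only: tuple_boundary_def frag_cmul_sum frag_cmul_cmul mult.assoc)
qed

lemma chain_complex_multiterm: "chain_complex (multiterm_complex X k star a)"
    (is "chain_complex ?C")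
  unfolding chain_complex_def
proof (intro conjI allI ballI)
  fix n
  show "comm_group (grp ?C n)"
    by (simp add: abelian_free_Abelian_group)
  show "bdy ?C n \<in> hom (grp ?C n) (grp ?C (n - 1))"
  proof (cases "1 \<le> n")
    case True
    then have "frag_extend (tuple_boundary k star a (nat n)) \<in> hom (grp ?C n) (grp ?C (n - 1))"
      using tuple_boundary_closed by (simp add: frag_extend_hom)
    then show ?thesis
      using True by (simp add: bdy_multiterm_complex [abs_def])
  next
    case False
    then show ?thesis
      by (simp add: bdy_multiterm_complex [abs_def] hom_def)
  qed
  fix c assume c: "c \<in> carrier (grp ?C n)"
  show "bdy ?C (n - 1) (bdy ?C n c) = \<one>\<^bsub>grp ?C (n - 2)\<^esub>"
  proof (cases "2 \<le> n")
    case True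
    define p where "p = nat (n - 2)"
    have n: "n = int (Suc (Suc p))" "nat n = Suc (Suc p)" "nat (n - 1) = Suc p"
      using True by (simp_all add: p_def)
    have "frag_extend (\<lambda>xs. frag_extend (tuple_boundary k star a (Suc p))
        (tuple_boundary k star a (Suc (Suc p)) xs)) c = 0"
      using c n by (intro frag_extend_eq_0 tuple_boundary_tuple_boundary) auto
    then show ?thesis
      using True by (simp add: bdy_multiterm_complex frag_extend_frag_extend n(2,3))
  qed (simp add: bdy_multiterm_complex)
qed

end

section \<open>The two retractions\<close>

text \<open>In degree \<open>0\<close> the map is set to zero, since there \<open>d\<^sub>0\<close> lands in the trivial group of degree
  \<open>-1\<close>; \<open>redouble [x]\<close> itself has no meaning, as \<open>hd []\<close> is unspecified.\<close>

definition redouble_chain :: "int \<Rightarrow> ('a list \<Rightarrow>\<^sub>0 int) \<Rightarrow> ('a list \<Rightarrow>\<^sub>0 int)" where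
  "redouble_chain n c = (if 1 \<le> n then frag_extend (\<lambda>xs. frag_of (redouble xs)) c else 0)"

lemma s0_hom:
  "s0 \<in> hom (free_Abelian_group (tuples Y (n - 1))) (free_Abelian_group (tuples Y n))"
  unfolding s0_def
proof (rule frag_extend_hom)
  fix xs assume "xs \<in> tuples Y (n - 1)"
  then have "hd xs # xs \<in> tuples Y n"
    by (cases xs) (auto simp: tuples_def)
  then show "Poly_Mapping.keys (frag_of (hd xs # xs)) \<subseteq> tuples Y n"
    by simp
qed

lemma redouble_chain_s0:
  assumes "c \<in> carrier (free_Abelian_group (tuples Y (n - 1)))"
  shows "redouble_chain n (s0 c) = s0 c"
proof (cases "1 \<le> n")
  case True
  then show ?thesis
    by (simp add: redouble_chain_def s0_def frag_extend_frag_extend redouble_def)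
next
  case False
  then have "tuples Y (n - 1) = {}"
    by (simp add: tuples_def)
  then show ?thesis
    using assms by (simp add: redouble_chain_def s0_def)
qed

text \<open>The preimage under \<open>s\<^sub>0\<close> is \<open>d\<^sub>0 c\<close>, or zero in degree \<open>0\<close>.\<close>

lemma redouble_chain_in_s0_image:
  assumes "c \<in> carrier (free_Abelian_group (tuples Y n))"
  obtains b where "b \<in> carrier (free_Abelian_group (tuples Y (n - 1)))" and "redouble_chain n c = s0 b"
proof (cases "1 \<le> n")
  case True
  have "frag_extend (\<lambda>xs. frag_of (tl xs))
      \<in> hom (free_Abelian_group (tuples Y n)) (free_Abelian_group (tuples Y (n - 1)))"
  proof (rule frag_extend_hom)
    fix xs assume "xs \<in> tuples Y n"
    then have "tl xs \<in> tuples Y (n - 1)"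
      using True by (cases xs) (auto simp: tuples_def)
    then show "Poly_Mapping.keys (frag_of (tl xs)) \<subseteq> tuples Y (n - 1)"
      by simp
  qed
  then have "frag_extend (\<lambda>xs. frag_of (tl xs)) c \<in> carrier (free_Abelian_group (tuples Y (n - 1)))"
    using assms by (rule hom_in_carrier)
  moreover have "redouble_chain n c = s0 (frag_extend (\<lambda>xs. frag_of (tl xs)) c)"
    using True by (simp add: redouble_chain_def s0_def frag_extend_frag_extend redouble_def)
  ultimately show ?thesis
    by (rule that)
next
  case False
  then show ?thesis
    using that [of 0] by (simp add: redouble_chain_def s0_def)
qed

lemma redouble_chain_hom:
  "redouble_chain n \<in> hom (free_Abelian_group (tuples Y n)) (free_Abelian_group (tuples Y n))"
proof (rule homI)
  fix c assume "c \<in> carrier (free_Abelian_group (tuples Y n))"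
  then obtain b where "b \<in> carrier (free_Abelian_group (tuples Y (n - 1)))" "redouble_chain n c = s0 b"
    by (rule redouble_chain_in_s0_image)
  then show "redouble_chain n c \<in> carrier (free_Abelian_group (tuples Y n))"
    using hom_in_carrier [OF s0_hom] by simp
qed (simp add: redouble_chain_def frag_extend_add)

locale pointed_multispindle = multispindle X k star
  for X :: "'a set" and k :: nat and star :: "nat \<Rightarrow> 'a \<Rightarrow> 'a \<Rightarrow> 'a" +
  fixes a :: "nat \<Rightarrow> int" and t :: 'a
  assumes base: "t \<in> X"
begin

abbreviation "multi_chains \<equiv> multiterm_complex X k star a"
abbreviation "basepoint_chains n \<equiv> generate (grp multi_chains n) (frag_of ` tuples {t} n)"

lemma basepoint_chains: "basepoint_chains n = carrier (free_Abelian_group (tuples {t} n))"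
proof -
  have "tuples {t} n \<subseteq> tuples X n"
    using base by (auto simp: tuples_def)
  then show ?thesis
    by (simp add: generate_frag_of)
qed

definition collapse :: "('a list \<Rightarrow>\<^sub>0 int) \<Rightarrow> ('a list \<Rightarrow>\<^sub>0 int)" where
  "collapse = frag_extend (\<lambda>xs. frag_of (replicate (length xs) t))"

lemma complex_retraction_collapse:
  "complex_retraction multi_chains basepoint_chains (\<lambda>n. collapse)"
proof
  show "chain_complex multi_chains"
    by (rule chain_complex_multiterm)
  fix n
  have into: "collapse \<in> hom (grp multi_chains n) (free_Abelian_group (tuples {t} n))"
    unfolding collapse_def grp_multiterm_complex
    by (rule frag_extend_hom) (auto simp: tuples_def)
  have "tuples {t} n \<subseteq> tuples X n"
    using base by (auto simp: tuples_def)
  then have sub: "carrier (free_Abelian_group (tuples {t} n)) \<subseteq> carrier (grp multi_chains n)"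
    by auto
  show "collapse \<in> hom (grp multi_chains n) (grp multi_chains n)"
    using subsetD [OF sub hom_in_carrier [OF into]] hom_mult [OF into]
    by (intro homI) (simp_all del: carrier_free_Abelian_group_iff)
  show fixed: "collapse c = c" if "c \<in> basepoint_chains n" for c
    unfolding collapse_def
  proof (rule frag_extend_fixed)
    fix xs assume "xs \<in> Poly_Mapping.keys c"
    then have "xs \<in> tuples {t} n"
      using that unfolding basepoint_chains by auto
    then have "set xs \<subseteq> {t}"
      by (simp add: tuples_def)
    then show "frag_of (replicate (length xs) t) = frag_of xs"
      by (metis replicate_eqI singletonD subsetD)
  qed
  show "collapse ` carrier (grp multi_chains n) = basepoint_chains n"
  proof
    show "collapse ` carrier (grp multi_chains n) \<subseteq> basepoint_chains n"
      using hom_in_carrier [OF into] unfolding basepoint_chains by blast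
    show "basepoint_chains n \<subseteq> collapse ` carrier (grp multi_chains n)"
    proof
      fix c assume c: "c \<in> basepoint_chains n"
      then have "c \<in> carrier (grp multi_chains n)"
        using sub unfolding basepoint_chains by blast
      then show "c \<in> collapse ` carrier (grp multi_chains n)"
        by (rule rev_image_eqI) (simp only: fixed [OF c])
    qed
  qed
  show "collapse (bdy multi_chains n c) = bdy multi_chains n (collapse c)"
    if c: "c \<in> carrier (grp multi_chains n)" for c
  proof (cases "1 \<le> n")
    case True
    define m where "m = nat (n - 1)"
    have n: "nat n = Suc m"
      using True by (simp add: m_def)
    have "frag_extend (\<lambda>ys. frag_of (replicate (length ys) t)) (tuple_boundary k star a (Suc m) xs)
        = tuple_boundary k star a (Suc m) (replicate (length xs) t)"
      if "xs \<in> Poly_Mapping.keys c" for xs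
    proof -
      have len: "length xs = Suc (Suc m)"
        using that c True by (auto simp: tuples_def m_def)
      have "replicate (length (face (star r) i xs)) t = face (star r) i (replicate (length xs) t)"
        if "r \<in> {1..k}" "i \<le> Suc m" for r i
        using that idem [OF _ base] by (simp add: len length_face face_replicate del: replicate_Suc)
      then show ?thesis
        unfolding frag_extend_tuple_boundary
        unfolding tuple_boundary_def
        by (intro sum.cong refl arg_cong [where f = "frag_cmul _"]) simp
    qed
    then show ?thesis
      using True
      by (simp add: bdy_multiterm_complex collapse_def frag_extend_frag_extend n cong: frag_extend_eq)
  next
    case False
    then show ?thesis
      by (simp add: bdy_multiterm_complex collapse_def)
  qed
qed

text \<open>In degree \<open>1\<close> one side vanishes since \<open>s\<^sub>0 d\<^sub>0\<close> is zero in degree \<open>0\<close>, the other since the faces 0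
  and 1 of \<open>(y, y)\<close> cancel. In higher degrees the faces 0 and 1 cancel on both sides, and the others
  commute with \<open>s\<^sub>0 d\<^sub>0\<close> one by one.\<close>

lemma redouble_chain_commutes:
  assumes c: "c \<in> carrier (grp multi_chains n)"
  shows "redouble_chain (n - 1) (bdy multi_chains n c) = bdy multi_chains n (redouble_chain n c)"
proof -
  consider "n < 1" | "n = 1" | "2 \<le> n"
    by linarith
  then show ?thesis
  proof cases
    case 1
    then show ?thesis
      by (simp add: bdy_multiterm_complex redouble_chain_def)
  next
    case 2
    have "tuple_boundary k star a 1 (redouble xs) = 0" if "xs \<in> Poly_Mapping.keys c" for xs
    proof -
      have xs: "length xs = Suc (Suc 0)" "set xs \<subseteq> X"
        using that c 2 by (auto simp: tuples_def)
      then obtain x y where "xs = [x, y]" "y \<in> X"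
        by (auto simp: length_Suc_conv)
      then show ?thesis
        unfolding tuple_boundary_def
        by (intro sum.neutral ballI) (simp add: face_0_redouble face_1_redouble idem)
    qed
    then show ?thesis
      by (simp add: 2 bdy_multiterm_complex redouble_chain_def frag_extend_frag_extend frag_extend_eq_0)
  next
    case 3
    define q where "q = nat (n - 2)"
    have n: "nat n = Suc (Suc q)"
      using 3 by (simp add: q_def)
    have "frag_extend (\<lambda>ys. frag_of (redouble ys)) (tuple_boundary k star a (Suc (Suc q)) xs)
        = tuple_boundary k star a (Suc (Suc q)) (redouble xs)"
      if "xs \<in> Poly_Mapping.keys c" for xs
    proof -
      have xs: "length xs = Suc (Suc (Suc q))" "set xs \<subseteq> X"
        using that c 3 by (auto simp: tuples_def q_def)
      then obtain x y z zs where eq: "xs = x # y # z # zs" "y \<in> X"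
        by (auto simp: length_Suc_conv)
      have inner: "(\<Sum>i\<le>Suc (Suc q). frag_cmul ((-1) ^ i) (frag_of (redouble (face (star r) i xs))))
          = (\<Sum>i\<le>Suc (Suc q). frag_cmul ((-1) ^ i) (frag_of (face (star r) i (redouble xs))))"
        if "r \<in> {1..k}" for r
        using idem [OF that eq(2)]
        by (simp add: eq(1) sum.atMost_Suc_shift redouble_face redouble_face_01 face_0_redouble
            face_1_redouble del: sum.atMost_Suc)
      show ?thesis
        unfolding frag_extend_tuple_boundary
        unfolding tuple_boundary_def
        by (rule sum.cong [OF refl]) (simp only: inner)
    qed
    then show ?thesis
      using 3
      by (simp add: bdy_multiterm_complex redouble_chain_def frag_extend_frag_extend n cong: frag_extend_eq)
  qed
qed

abbreviation "reduced \<equiv> quotient_complex multi_chains (subcomplex multi_chains basepoint_chains)"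

abbreviation "F0_chains n \<equiv>
  coset_map (grp multi_chains n) (basepoint_chains n) s0 ` carrier (grp reduced (n - 1))"

abbreviation "redouble_coset n \<equiv>
  coset_map (grp multi_chains n) (basepoint_chains n) (redouble_chain n)"

text \<open>The map \<open>s\<^sub>0 d\<^sub>0\<close> descends to \<open>C(X,t)\<close> because it maps constant tuples to constant tuples. In terms
  of representatives \<open>\<F>\<^sup>0\<close> consists of the classes of the chains \<open>s\<^sub>0 c\<close>, so being fixed and being
  the image are both read off from \<open>redouble_chain_s0\<close> and \<open>redouble_chain_in_s0_image\<close>.\<close>

lemma complex_retraction_redouble:
  "complex_retraction reduced F0_chains redouble_coset"
proof -
  interpret P: complex_retraction multi_chains basepoint_chains "\<lambda>n. collapse"
    by (rule complex_retraction_collapse)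
  let ?cos = "\<lambda>n c. basepoint_chains n #>\<^bsub>grp multi_chains n\<^esub> c"
  have grp: "grp reduced n = grp multi_chains n Mod basepoint_chains n" for n
    by (simp add: quotient_complex_def subcomplex_def)
  have group: "group (grp multi_chains n)" for n
    by simp
  have hom: "redouble_chain n \<in> hom (grp multi_chains n) (grp multi_chains n)" for n
    by (simp add: redouble_chain_hom)
  have base_closed: "redouble_chain n ` basepoint_chains n \<subseteq> basepoint_chains n" for n
    using hom_in_carrier [OF redouble_chain_hom [of n "{t}"]] unfolding basepoint_chains by blast
  have rho: "redouble_coset n (?cos n c) = ?cos n (redouble_chain n c)"
    if "c \<in> carrier (grp multi_chains n)" for n c
    by (rule coset_map_r_coset [OF group group hom P.subgroup P.subgroup base_closed that])
  have F0: "F0_chains n = (\<lambda>c. ?cos n (s0 c)) ` carrier (grp multi_chains (n - 1))" for n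
  proof -
    have "s0 \<in> hom (grp multi_chains (n - 1)) (grp multi_chains n)"
      by (simp add: s0_hom)
    moreover have "s0 ` basepoint_chains (n - 1) \<subseteq> basepoint_chains n"
      using hom_in_carrier [OF s0_hom [of "{t}" n]] unfolding basepoint_chains by blast
    ultimately have "coset_map (grp multi_chains n) (basepoint_chains n) s0 (?cos (n - 1) c)
        = ?cos n (s0 c)" if "c \<in> carrier (grp multi_chains (n - 1))" for c
      using coset_map_r_coset [OF group group _ P.subgroup P.subgroup _ that] by blast
    then show ?thesis
      unfolding grp carrier_FactGroup image_image by (rule image_cong [OF refl])
  qed
  have s0_carrier: "s0 c \<in> carrier (grp multi_chains n)"
    if "c \<in> carrier (grp multi_chains (n - 1))" for n c
    using hom_in_carrier [OF s0_hom] that unfolding grp_multiterm_complex by blast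
  have fixed: "redouble_coset n A = A" if "A \<in> F0_chains n" for n A
  proof -
    obtain c where c: "c \<in> carrier (grp multi_chains (n - 1))" and A: "A = ?cos n (s0 c)"
      using \<open>A \<in> F0_chains n\<close> unfolding F0 by blast
    have "redouble_chain n (s0 c) = s0 c"
      using c unfolding grp_multiterm_complex by (rule redouble_chain_s0)
    then show ?thesis
      unfolding A rho [OF s0_carrier [OF c]] by simp
  qed
  show ?thesis
  proof
    show "chain_complex reduced"
      by (rule P.complex_quotient)
    fix n
    show "redouble_coset n \<in> hom (grp reduced n) (grp reduced n)"
      unfolding grp
      by (rule coset_map_hom [OF group group hom _ _ base_closed])
        (simp_all only: comm_group.subgroup_imp_normal [OF P.comm P.subgroup])
    show "redouble_coset n A = A" if "A \<in> F0_chains n" for A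
      using that by (rule fixed)
    show "redouble_coset n ` carrier (grp reduced n) = F0_chains n"
    proof
      show "redouble_coset n ` carrier (grp reduced n) \<subseteq> F0_chains n"
      proof (rule image_subsetI)
        fix A assume "A \<in> carrier (grp reduced n)"
        then obtain c where c: "c \<in> carrier (grp multi_chains n)" and A: "A = ?cos n c"
          unfolding grp carrier_FactGroup by blast
        obtain b where "b \<in> carrier (grp multi_chains (n - 1))" "redouble_chain n c = s0 b"
          using c redouble_chain_in_s0_image [of c X n] unfolding grp_multiterm_complex by blast
        then show "redouble_coset n A \<in> F0_chains n"
          unfolding F0 A rho [OF c] by auto
      qed
      show "F0_chains n \<subseteq> redouble_coset n ` carrier (grp reduced n)"
      proof
        fix A assume A: "A \<in> F0_chains n"
        then have "A \<in> carrier (grp reduced n)"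
          using s0_carrier unfolding F0 unfolding grp carrier_FactGroup by blast
        then show "A \<in> redouble_coset n ` carrier (grp reduced n)"
          by (rule rev_image_eqI) (simp only: fixed [OF A])
      qed
    qed
    show "redouble_coset (n - 1) (bdy reduced n A) = bdy reduced n (redouble_coset n A)"
      if A': "A \<in> carrier (grp reduced n)" for A
    proof -
      obtain c where c: "c \<in> carrier (grp multi_chains n)" and A: "A = ?cos n c"
        using A' unfolding grp carrier_FactGroup by blast
      have bc: "bdy multi_chains n c \<in> carrier (grp multi_chains (n - 1))"
        by (rule group_hom.hom_closed [OF chain_complex_group_hom [OF P.complex] c])
      show ?thesis
        unfolding A P.bdy_coset [OF c] rho [OF c] rho [OF bc]
          P.bdy_coset [OF hom_in_carrier [OF hom c]]
        by (simp only: redouble_chain_commutes [OF c])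
    qed
  qed
qed

end

theorem corollary4p7:
  fixes X :: "'a set" and k :: nat and star :: "nat \<Rightarrow> 'a \<Rightarrow> 'a \<Rightarrow> 'a"
    and a :: "nat \<Rightarrow> int" and t :: 'a
  assumes "multispindle X k star" and "t \<in> X"
  shows "complex_iso (multiterm_complex X k star a)
           (complex_sum (point_complex X k star a t)
             (complex_sum (F0_complex X k star a t) (mod_F0_complex X k star a t))) \<and>
         (\<forall>n. homology n (multiterm_complex X k star a) \<cong>
           homology n (point_complex X k star a t) \<times>\<times>
           homology n (F0_complex X k star a t) \<times>\<times>
           homology n (mod_F0_complex X k star a t))"
proof -
  interpret pointed_multispindle X k star a t
    using assms by (simp add: pointed_multispindle_def pointed_multispindle_axioms_def)
  interpret P: complex_retraction multi_chains basepoint_chains "\<lambda>n. collapse"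
    by (rule complex_retraction_collapse)
  interpret F: complex_retraction reduced F0_chains redouble_coset
    by (rule complex_retraction_redouble)
  let ?P = "point_complex X k star a t" and ?F = "F0_complex X k star a t"
    and ?Q = "mod_F0_complex X k star a t"
  have P: "subcomplex multi_chains basepoint_chains = ?P"
    by (simp add: point_complex_def)
  have R: "reduced = reduced_complex X k star a t"
    by (simp add: reduced_complex_def point_complex_def)
  have F: "subcomplex reduced F0_chains = ?F"
    by (simp add: F0_complex_def reduced_complex_def point_complex_def subcomplex_def)
  have Q: "quotient_complex reduced (subcomplex reduced F0_chains) = ?Q"
    unfolding F unfolding R mod_F0_complex_def by (rule refl)
  have complexes: "chain_complex ?P" "chain_complex ?F" "chain_complex ?Q"
    using P.complex_sub F.complex_sub F.complex_quotient unfolding Q unfolding F unfolding P .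
  have "complex_iso reduced (complex_sum ?F ?Q)"
    using F.splitting unfolding Q unfolding F .
  with complexes(1) have
    "complex_iso (complex_sum ?P reduced) (complex_sum ?P (complex_sum ?F ?Q))"
    by (rule complex_iso_sum_right)
  with P.splitting [unfolded P] have
    iso: "complex_iso multi_chains (complex_sum ?P (complex_sum ?F ?Q))"
    unfolding P by (rule complex_iso_trans)
  have "homology n multi_chains \<cong> homology n ?P \<times>\<times> homology n ?F \<times>\<times> homology n ?Q" for n
  proof -
    have "homology n multi_chains \<cong> homology n (complex_sum ?P (complex_sum ?F ?Q))"
      by (rule homology_complex_iso [OF iso])
    also have "\<dots> \<cong> homology n ?P \<times>\<times> homology n (complex_sum ?F ?Q)"
      using complexes by (intro homology_complex_sum chain_complex_sum)
    also have "\<dots> \<cong> homology n ?P \<times>\<times> homology n ?F \<times>\<times> homology n ?Q"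
      by (rule group.DirProd_iso_trans [OF group_homology [OF complexes(1)] iso_refl
            homology_complex_sum [OF complexes(2,3)]])
    finally show ?thesis .
  qed
  with iso show ?thesis
    by blast
qed

end
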